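(* Let $K$ be a field of characteristic zero. The map $\psi:\mathbf{QSh}^g_d\to\mathbf{Sh}$ defined by $\psi(\emptyset)=\emptyset$ and, for pairwise distinct $n_1,\dots,n_k\in\mathbb N^\ast$ ($k\ge1$), $$\psi([n_1\dots n_k])=\sum_{\mu_1+\dots+\mu_r=k}\frac{(-1)^{k-r}}{\mu_1\cdots\mu_r}\;Q_1Q_2\cdots Q_r,\qquad Q_s=\sum_{j=M_{s-1}+1}^{M_s}\frac{[n_j]}{\prod_{l\ne j,\ M_{s-1}+1\le l\le M_s}(n_j-n_l)},$$ where the sum runs over all $r\ge1$ and positive integers $\mu_1,\dots,\mu_r$ with sum $k$, $M_0=0$, $M_s=\mu_1+\dots+\mu_s$, and $Q_1\cdots Q_r$ is the (multilinear) concatenation product of words, defines a linear embedding of $\mathbf{QSh}^g_d$ into $\mathbf{Sh}$ and is a regularizing bialgebra map. In particular, the product and coproduct maps on $\mathbf{QSh}^g_d$ are mapped to the product and coproduct on $\mathbf{Sh}$.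
   Context: All spaces are over $K$; all maps are linear; $\mathbb N^\ast$ is the set of positive integers. $\mathbf{Sh}$ is the integer shuffle bialgebra: the span of all words $[n_1\dots n_k]$, $n_i\in\mathbb N^\ast$, $k\ge0$, graded by word length, with unit the empty word $\emptyset$, the deconcatenation coproduct $\Delta([n_1\dots n_k])=\sum_{i=0}^k[n_1\dots n_i]\otimes[n_{i+1}\dots n_k]$, and the shuffle product $\sqcup\!\sqcup$ defined recursively by $$[n_1\dots n_k]\sqcup\!\sqcup[m_1\dots m_l]=[n_1(n_2\dots n_k\sqcup\!\sqcup m_1\dots m_l)]+[m_1(n_1\dots n_k\sqcup\!\sqcup m_2\dots m_l)],$$ where $[n(w)]$ denotes concatenation of the letter $n$ in front of $w$. A word over $\mathbb N^\ast$ is generic if no letter appears twice. Two generic words are in generic position if they have no letter in common; two linear combinations of generic words are in generic position if every pair of words occurring in them is. The generic divided quasi-shuffle bialgebra $\mathbf{QSh}^g_d$ is the span $T^g(\mathbb N^\ast)$ of generic words, graded by word length, with the deconcatenation coproduct $\Delta$ and the partially defined product $\overline\star$ (defined on elements in generic position, with unit $\emptyset$) given recursively by $$[n_1\dots n_k]\,\overline\star\,[m_1\dots m_l]=[n_1(n_2\dots n_k\,\overline\star\,m_1\dots m_l)]+[m_1(n_1\dots n_k\,\overline\star\,m_2\dots m_l)]$$ $$+\frac1{n_1-m_1}\big\{[n_1(n_2\dots n_k\,\overline\star\,m_2\dots m_l)]-[m_1(n_2\dots n_k\,\overline\star\,m_2\dots m_l)]\big\}.$$ A regularizing bialgebra map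 from such a generic bialgebra $H$ (with product $\mu$ defined on elements in generic position, and coproduct $\Delta$) to a graded Hopf algebra $H'$ (product $\mu'$, coproduct $\Delta'$) is a morphism of graded vector spaces $f$ that sends the unit $\emptyset$ of $H$ to the unit of $H'$ and satisfies $f(\mu(h\otimes h'))=\mu'(f(h)\otimes f(h'))$ for all $h,h'$ in generic position in $H$ and $(f\otimes f)\circ\Delta(h)=\Delta'(f(h))$.
   Formalization: The map ψ does not preserve word length (ψ([1 2]) = [1 2] + ½[1] − ½[2]), so "morphism of graded vector spaces" is replaced by: ψ is linear and maps the span of words of length ≤ n into the span of words of length ≤ n, for every n. *)

theory Defs
  imports Complex_Main "HOL-Library.Poly_Mapping"
begin

section \<open>Free vector spaces\<close>

text \<open>The vector space with basis \<open>'b\<close> is the type of finitely supported coefficient functions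
  \<open>'b \<Rightarrow>\<^sub>0 'k\<close>. The tensor square of the span of \<open>B\<close> is the span of \<open>B \<times> B\<close>.\<close>

definition scale :: "'k \<Rightarrow> ('b \<Rightarrow>\<^sub>0 'k) \<Rightarrow> ('b \<Rightarrow>\<^sub>0 'k::field)"
  where "scale c x = Poly_Mapping.map ((*) c) x"

definition bvec :: "'b \<Rightarrow> ('b \<Rightarrow>\<^sub>0 'k::field)"
  where "bvec b = Poly_Mapping.single b 1"

definition lin_ext :: "('b \<Rightarrow> ('c \<Rightarrow>\<^sub>0 'k)) \<Rightarrow> ('b \<Rightarrow>\<^sub>0 'k) \<Rightarrow> ('c \<Rightarrow>\<^sub>0 'k::field)"
  where "lin_ext F x = (\<Sum>b\<in>Poly_Mapping.keys x. scale (Poly_Mapping.lookup x b) (F b))"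

definition bilin_ext ::
  "('a \<Rightarrow> 'b \<Rightarrow> ('c \<Rightarrow>\<^sub>0 'k)) \<Rightarrow> ('a \<Rightarrow>\<^sub>0 'k) \<Rightarrow> ('b \<Rightarrow>\<^sub>0 'k) \<Rightarrow> ('c \<Rightarrow>\<^sub>0 'k::field)"
  where "bilin_ext F x y = lin_ext (\<lambda>a. lin_ext (F a) y) x"

definition tensor :: "('a \<Rightarrow>\<^sub>0 'k) \<Rightarrow> ('b \<Rightarrow>\<^sub>0 'k) \<Rightarrow> (('a \<times> 'b) \<Rightarrow>\<^sub>0 'k::field)"
  where "tensor = bilin_ext (\<lambda>a b. bvec (a, b))"

definition tensor_map ::
  "(('a \<Rightarrow>\<^sub>0 'k) \<Rightarrow> ('b \<Rightarrow>\<^sub>0 'k)) \<Rightarrow> (('a \<times> 'a) \<Rightarrow>\<^sub>0 'k) \<Rightarrow> (('b \<times> 'b) \<Rightarrow>\<^sub>0 'k::field)"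
  where "tensor_map f = lin_ext (\<lambda>(a, b). tensor (f (bvec a)) (f (bvec b)))"

definition linear_map_on ::
  "('b \<Rightarrow>\<^sub>0 'k::field) set \<Rightarrow> ('c \<Rightarrow>\<^sub>0 'k) set \<Rightarrow> (('b \<Rightarrow>\<^sub>0 'k) \<Rightarrow> ('c \<Rightarrow>\<^sub>0 'k)) \<Rightarrow> bool"
  where "linear_map_on V W f \<longleftrightarrow>
    f ` V \<subseteq> W \<and>
    (\<forall>x\<in>V. \<forall>y\<in>V. f (x + y) = f x + f y) \<and>
    (\<forall>c. \<forall>x\<in>V. f (scale c x) = scale c (f x))"

definition linear_embedding_on ::
  "('b \<Rightarrow>\<^sub>0 'k::field) set \<Rightarrow> ('c \<Rightarrow>\<^sub>0 'k) set \<Rightarrow> (('b \<Rightarrow>\<^sub>0 'k) \<Rightarrow> ('c \<Rightarrow>\<^sub>0 'k)) \<Rightarrow> bool"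
  where "linear_embedding_on V W f \<longleftrightarrow> linear_map_on V W f \<and> inj_on f V"


section \<open>Bialgebras with a graded basis and regularizing maps\<close>

record (overloaded) ('b, 'k) based_bialgebra =
  basis :: "'b set"
  grade :: "'b \<Rightarrow> nat"
  one_el :: "'b \<Rightarrow>\<^sub>0 'k"
  mult :: "('b \<Rightarrow>\<^sub>0 'k) \<Rightarrow> ('b \<Rightarrow>\<^sub>0 'k) \<Rightarrow> ('b \<Rightarrow>\<^sub>0 'k)"
  comult :: "('b \<Rightarrow>\<^sub>0 'k) \<Rightarrow> (('b \<times> 'b) \<Rightarrow>\<^sub>0 'k)"

text \<open>In a generic bialgebra \<open>mult\<close> is meaningful only on elements in generic position.\<close>

record (overloaded) ('b, 'k) generic_bialgebra = "('b, 'k) based_bialgebra" +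
  indep :: "'b \<Rightarrow> 'b \<Rightarrow> bool"

definition space :: "('b, 'k::field, 'm) based_bialgebra_scheme \<Rightarrow> ('b \<Rightarrow>\<^sub>0 'k) set"
  where "space H = {x. Poly_Mapping.keys x \<subseteq> basis H}"

definition filt :: "('b, 'k::field, 'm) based_bialgebra_scheme \<Rightarrow> nat \<Rightarrow> ('b \<Rightarrow>\<^sub>0 'k) set"
  where "filt H n = {x \<in> space H. \<forall>b\<in>Poly_Mapping.keys x. grade H b \<le> n}"

definition generic_position ::
  "('b, 'k::field, 'm) generic_bialgebra_scheme \<Rightarrow> ('b \<Rightarrow>\<^sub>0 'k) \<Rightarrow> ('b \<Rightarrow>\<^sub>0 'k) \<Rightarrow> bool"
  where "generic_position H x y \<longleftrightarrow>
    (\<forall>a\<in>Poly_Mapping.keys x. \<forall>b\<in>Poly_Mapping.keys y. indep H a b)"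

text \<open>Compatibility with the gradings is compatibility with the increasing filtrations they induce:
  a divided quasi-shuffle of words of lengths \<open>k\<close> and \<open>l\<close> has components in every length
  between \<open>max k l\<close> and \<open>k + l\<close>, and the map \<open>psi\<close> below does not preserve word length
  (lemma \<open>psi_not_length_homogeneous\<close>).\<close>

definition regularizing_bialgebra_map ::
  "('b, 'k::field, 'm) generic_bialgebra_scheme \<Rightarrow> ('c, 'k, 'n) based_bialgebra_scheme \<Rightarrow>
    (('b \<Rightarrow>\<^sub>0 'k) \<Rightarrow> ('c \<Rightarrow>\<^sub>0 'k)) \<Rightarrow> bool"
  where "regularizing_bialgebra_map H H' f \<longleftrightarrow>
    linear_map_on (space H) (space H') f \<and>
    (\<forall>n. f ` filt H n \<subseteq> filt H' n) \<and>
    f (one_el H) = one_el H' \<and>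
    (\<forall>x\<in>space H. \<forall>y\<in>space H. generic_position H x y \<longrightarrow>
        f (mult H x y) = mult H' (f x) (f y)) \<and>
    (\<forall>x\<in>space H. tensor_map f (comult H x) = comult H' (f x))"


section \<open>The integer shuffle bialgebra\<close>

definition words :: "nat list set"
  where "words = {w. 0 \<notin> set w}"

definition prepend :: "'a \<Rightarrow> ('a list \<Rightarrow>\<^sub>0 'k) \<Rightarrow> ('a list \<Rightarrow>\<^sub>0 'k::field)"
  where "prepend n = lin_ext (\<lambda>w. bvec (n # w))"

definition concat_prod :: "('a list \<Rightarrow>\<^sub>0 'k) \<Rightarrow> ('a list \<Rightarrow>\<^sub>0 'k) \<Rightarrow> ('a list \<Rightarrow>\<^sub>0 'k::field)"
  where "concat_prod = bilin_ext (\<lambda>u v. bvec (u @ v))"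

definition deconc :: "'a list \<Rightarrow> (('a list \<times> 'a list) \<Rightarrow>\<^sub>0 'k::field)"
  where "deconc w = (\<Sum>i\<le>length w. bvec (take i w, drop i w))"

fun shuffle :: "nat list \<Rightarrow> nat list \<Rightarrow> (nat list \<Rightarrow>\<^sub>0 'k::field)" where
  "shuffle [] v = bvec v"
| "shuffle (n # u) [] = bvec (n # u)"
| "shuffle (n # u) (m # v) =
     prepend n (shuffle u (m # v)) + prepend m (shuffle (n # u) v)"

definition Sh :: "(nat list, 'k::field) based_bialgebra"
  where "Sh = \<lparr> basis = words, grade = length, one_el = bvec [],
    mult = bilin_ext shuffle, comult = lin_ext deconc \<rparr>"


section \<open>The generic divided quasi-shuffle bialgebra\<close>

definition generic_words :: "nat list set"
  where "generic_words = {w \<in> words. distinct w}"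

text \<open>For words with a common letter the recursion may divide by \<open>0\<close>; these values are junk and
  never used.\<close>

fun dqshuffle :: "nat list \<Rightarrow> nat list \<Rightarrow> (nat list \<Rightarrow>\<^sub>0 'k::field_char_0)" where
  "dqshuffle [] v = bvec v"
| "dqshuffle (n # u) [] = bvec (n # u)"
| "dqshuffle (n # u) (m # v) =
     prepend n (dqshuffle u (m # v)) + prepend m (dqshuffle (n # u) v)
     + scale (1 / (of_nat n - of_nat m))
         (prepend n (dqshuffle u v) - prepend m (dqshuffle u v))"

definition QShgd :: "(nat list, 'k::field_char_0) generic_bialgebra"
  where "QShgd = \<lparr> basis = generic_words, grade = length, one_el = bvec [],
    mult = bilin_ext dqshuffle, comult = lin_ext deconc,
    indep = (\<lambda>u v. set u \<inter> set v = {}) \<rparr>"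


section \<open>The map psi\<close>

definition compositions :: "nat \<Rightarrow> nat list set"
  where "compositions k = {\<mu>. sum_list \<mu> = k \<and> 0 \<notin> set \<mu>}"

lemma finite_compositions: "finite (compositions k)"
proof (rule finite_subset)
  have "length \<mu> \<le> sum_list \<mu>" if "0 \<notin> set \<mu>" for \<mu> :: "nat list"
    using that by (induction \<mu>) auto
  then show "compositions k \<subseteq> {\<mu>. set \<mu> \<subseteq> {..k} \<and> length \<mu> \<le> k}"
    by (auto simp: compositions_def intro: member_le_sum_list)
  show "finite {\<mu>. set \<mu> \<subseteq> {..k} \<and> length \<mu> \<le> k}"
    by (rule finite_lists_length_le) simp
qed

text \<open>\<open>block w a b\<close> is the factor \<open>Q\<close> attached to the letters of \<open>w\<close> at the (zero-based) positions
  \<open>a, \<dots>, b - 1\<close>.\<close>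

definition block :: "nat list \<Rightarrow> nat \<Rightarrow> nat \<Rightarrow> (nat list \<Rightarrow>\<^sub>0 'k::field_char_0)"
  where "block w a b =
    (\<Sum>j\<in>{a..<b}. scale (1 / (\<Prod>l\<in>{a..<b} - {j}. of_nat (w ! j) - of_nat (w ! l))) (bvec [w ! j]))"

definition partial_sum :: "nat list \<Rightarrow> nat \<Rightarrow> nat"
  where "partial_sum \<mu> s = sum_list (take s \<mu>)"

definition block_product :: "nat list \<Rightarrow> nat list \<Rightarrow> (nat list \<Rightarrow>\<^sub>0 'k::field_char_0)"
  where "block_product w \<mu> =
    foldr concat_prod
      (map (\<lambda>s. block w (partial_sum \<mu> s) (partial_sum \<mu> (Suc s))) [0..<length \<mu>]) (bvec [])"

definition psi_word :: "nat list \<Rightarrow> (nat list \<Rightarrow>\<^sub>0 'k::field_char_0)"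
  where "psi_word w = (if w = [] then bvec [] else
    (\<Sum>\<mu>\<in>compositions (length w).
       scale ((- 1) ^ (length w - length \<mu>) / of_nat (prod_list \<mu>)) (block_product w \<mu>)))"

definition psi :: "(nat list \<Rightarrow>\<^sub>0 'k::field_char_0) \<Rightarrow> (nat list \<Rightarrow>\<^sub>0 'k)"
  where "psi = lin_ext psi_word"

lemma compositions_2: "compositions 2 = {[2], [1, 1]}"
proof -
  have "\<mu> = [2] \<or> \<mu> = [1, 1]" if "sum_list \<mu> = 2" "0 \<notin> set \<mu>" for \<mu> :: "nat list"
    using that
    by (cases \<mu>; cases "tl \<mu>"; cases "tl (tl \<mu>)") auto
  then show ?thesis by (auto simp: compositions_def)
qed

lemma lookup_scale: "Poly_Mapping.lookup (scale c x) b = c * Poly_Mapping.lookup x b"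
  by (simp add: scale_def Poly_Mapping.map.rep_eq when_def)

lemma scale_zero_left: "scale 0 x = 0"
  by (rule poly_mapping_eqI) (simp add: lookup_scale)

lemma lin_ext_bvec: "lin_ext F (bvec b) = F b"
  by (rule poly_mapping_eqI) (simp add: lin_ext_def bvec_def lookup_scale)

lemma lin_ext_scale_bvec: "lin_ext F (scale c (bvec b)) = scale c (F b)"
proof (cases "c = 0")
  case False
  then have "Poly_Mapping.keys (scale c (bvec b)) = {b}"
    by (auto simp: in_keys_iff lookup_scale bvec_def lookup_single when_def split: if_splits)
  then show ?thesis
    by (simp add: lin_ext_def lookup_scale bvec_def)
qed (simp add: scale_zero_left lin_ext_def)

lemma psi_not_length_homogeneous:
  "Poly_Mapping.lookup (psi (bvec [1, 2]) :: nat list \<Rightarrow>\<^sub>0 'k::field_char_0) [1] = 1 / 2"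
proof -
  have b: "{0..<2} - {0} = {Suc 0}" "{0..<2} - {Suc 0} = {0::nat}" "{0..<2::nat} = {0, Suc 0}"
    "{Suc 0..<2} = {Suc 0}"
    by auto
  have c: "{0..<Suc (Suc 0)} = {0, Suc 0}" "{0, Suc 0} - {0} = {Suc 0}"
    "{0, Suc 0} - {Suc 0} = {0::nat}" by auto
  have one: "scale 1 x = x" for x :: "nat list \<Rightarrow>\<^sub>0 'k"
    by (rule poly_mapping_eqI) (simp add: lookup_scale)
  have r: "concat_prod x (bvec []) = (x :: nat list \<Rightarrow>\<^sub>0 'k)" for x
    by (rule poly_mapping_eqI)
      (simp add: concat_prod_def bilin_ext_def lin_ext_bvec lin_ext_def lookup_sum lookup_scale
        lookup_single bvec_def when_def if_distrib sum.delta in_keys_iff cong: if_cong)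
  have bb: "concat_prod (bvec u) (bvec v) = (bvec (u @ v) :: nat list \<Rightarrow>\<^sub>0 'k)" for u v
    by (simp add: concat_prod_def bilin_ext_def lin_ext_bvec)
  have p2: "block_product [1, 2] [2] = (block [1, 2] 0 2 :: nat list \<Rightarrow>\<^sub>0 'k)"
    by (simp add: block_product_def partial_sum_def r)
  have p11: "block_product [1, 2] [1, 1] = (bvec [1, 2] :: nat list \<Rightarrow>\<^sub>0 'k)"
    by (simp add: block_product_def partial_sum_def r block_def one bb numeral_2_eq_2 upt_rec)
  have q: "Poly_Mapping.lookup (block [1, 2] 0 2 :: nat list \<Rightarrow>\<^sub>0 'k) [1] = - 1"
    by (simp add: block_def b c lookup_add lookup_scale bvec_def lookup_single)
  have eq: "(psi (bvec [1, 2]) :: nat list \<Rightarrow>\<^sub>0 'k) =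
    scale (- 1 / 2) (block_product [1, 2] [2]) + scale 1 (block_product [1, 2] [1, 1])"
    using compositions_2 by (simp add: psi_def lin_ext_bvec psi_word_def numeral_2_eq_2)
  show ?thesis
    unfolding eq p2 p11 lookup_add lookup_scale q by (simp add: bvec_def lookup_single)
qed

end

theory Submission
  imports Defs
begin

text \<open>Why the theorem holds.

  A coalgebra map into a deconcatenation coalgebra is determined by its component on one-letter words.
  For \<open>psi\<close> this component is, on a word of length \<open>k\<close>, the coefficient \<open>(-1) ^ (k - 1) / k\<close> of the
  logarithm times the block of all its letters (\<open>letter_part\<close>). Splitting a composition into its first
  part and the rest gives \<open>psi w = (\<Sum>w = a b. letter_part a \<cdot> psi b)\<close> for nonempty \<open>w\<close>
  (\<open>psi_word_rec\<close>), and everything is deduced from this recursion, by induction on the length.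

  The substitution \<open>[n] \<mapsto> 1 / (X - n)\<close> explains the denominators. The third term of the divided
  quasi-shuffle product is the partial fraction expansion of \<open>1 / ((X - n) (X - m))\<close>, and the block of
  a finite set \<open>S\<close> of letters is that of \<open>1 / (\<Prod>n\<in>S. X - n)\<close> (\<open>partial_fraction\<close>). So the
  product is a quasi-shuffle in which two letters that meet are multiplied, and the block of the letters
  of a quasi-shuffle of \<open>u\<close> and \<open>v\<close> does not depend on which letters met.

  Multiplicativity. The divided quasi-shuffle product is compatible with deconcatenation
  (\<open>lin_ext_cut_sum_dqshuffle\<close>), so the recursion expands \<open>psi (u \<star> v)\<close> over pairs of cuts of
  \<open>u\<close> and \<open>v\<close>. The main point is that \<open>letter_part\<close> vanishes on \<open>u \<star> v\<close> when both words are
  nonempty (\<open>lin_ext_letter_part_dqshuffle\<close>): all the blocks are equal, and the alternating sum of the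
  logarithm coefficients over all quasi-shuffles is \<open>0\<close>. Conceptually, this is the vanishing of the
  coefficient of \<open>x ^ k y ^ l\<close> in
  \<open>log (1 + x + y + x y) = log (1 + x) + log (1 + y)\<close>. Only the cuts with an empty prefix of \<open>u\<close> or of
  \<open>v\<close> remain, and they form the recursion that \<open>psi u\<close> shuffled with \<open>psi v\<close> satisfies
  (\<open>shuffle_psi_word\<close>).

  Comultiplicativity is the recursion together with coassociativity of deconcatenation
  (\<open>deconc_psi_word\<close>). Injectivity holds because \<open>psi w\<close> is \<open>w\<close> plus shorter words
  (\<open>psi_word_unitriangular\<close>).\<close>


section \<open>Linear maps between free vector spaces\<close>

lemma module_scale: "module (scale :: 'k::field \<Rightarrow> ('b \<Rightarrow>\<^sub>0 'k) \<Rightarrow> _)"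
  by standard (auto intro!: poly_mapping_eqI simp: lookup_scale lookup_add algebra_simps)

abbreviation lin :: "(('b \<Rightarrow>\<^sub>0 'k::field) \<Rightarrow> ('c \<Rightarrow>\<^sub>0 'k)) \<Rightarrow> bool"
  where "lin \<equiv> module_hom scale scale"

lemmas scale_right_distrib = module.scale_right_distrib[OF module_scale]
lemmas scale_left_distrib = module.scale_left_distrib[OF module_scale]
lemmas scale_scale = module.scale_scale[OF module_scale]
lemmas scale_one = module.scale_one[OF module_scale]
lemmas scale_sum_right = module.scale_sum_right[OF module_scale]
lemmas scale_left_diff_distrib = module.scale_left_diff_distrib[OF module_scale]
lemmas scale_right_diff_distrib = module.scale_right_diff_distrib[OF module_scale]

lemma linI:
  assumes "\<And>x y. f (x + y) = f x + f y" "\<And>c x. f (scale c x) = scale c (f x)"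
  shows "lin f"
  using assms by (auto simp: module_hom_iff module_scale)

lemmas lin_addD = module_hom.add[of scale scale]
lemmas lin_scaleD = module_hom.scale[of scale scale]
lemmas lin_sumD = module_hom.sum[of scale scale]
lemmas lin_zeroD = module_hom.zero[of scale scale]
lemmas lin_diffD = module_hom.diff[of scale scale]

lemma lin_ext_superset:
  assumes "finite A" "Poly_Mapping.keys x \<subseteq> A"
  shows "lin_ext F x = (\<Sum>b\<in>A. scale (Poly_Mapping.lookup x b) (F b))"
  unfolding lin_ext_def using assms
  by (intro sum.mono_neutral_left) (auto simp: in_keys_iff scale_zero_left)

lemma lin_lin_ext:
  fixes F :: "'b \<Rightarrow> ('c \<Rightarrow>\<^sub>0 'k::field)"
  shows "lin (lin_ext F)"
proof (rule linI)
  fix x y :: "'b \<Rightarrow>\<^sub>0 'k" and c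
  let ?A = "Poly_Mapping.keys x \<union> Poly_Mapping.keys y"
  have "Poly_Mapping.keys (x + y) \<subseteq> ?A" by (rule Poly_Mapping.keys_add)
  then show "lin_ext F (x + y) = lin_ext F x + lin_ext F y"
    by (simp add: lin_ext_superset[where A = ?A] lookup_add scale_left_distrib sum.distrib)
  have "Poly_Mapping.keys (scale c x) \<subseteq> ?A"
    by (auto simp: in_keys_iff lookup_scale)
  then show "lin_ext F (scale c x) = scale c (lin_ext F x)"
    by (simp add: lin_ext_superset[where A = ?A] lookup_scale scale_scale scale_sum_right)
qed

lemma lin_id: "lin (\<lambda>x. x)"
  by (rule linI) simp_all

lemma lin_comp: "lin f \<Longrightarrow> lin g \<Longrightarrow> lin (\<lambda>x. f (g x))"
  using module_hom_compose[of scale scale g scale f] by (simp add: comp_def)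

lemma lin_add: "lin f \<Longrightarrow> lin g \<Longrightarrow> lin (\<lambda>x. f x + g x)"
  by (rule linI) (simp_all add: lin_addD lin_scaleD scale_right_distrib)

lemma lin_scale: "lin f \<Longrightarrow> lin (\<lambda>x. scale c (f x))"
  by (rule linI) (simp_all add: lin_addD lin_scaleD scale_right_distrib scale_scale mult.commute)

lemma lin_sum: "(\<And>i. lin (f i)) \<Longrightarrow> lin (\<lambda>x. \<Sum>i\<in>I. f i x)"
  by (rule linI) (simp_all add: lin_addD lin_scaleD sum.distrib scale_sum_right)

lemma lin_ext_bvec_id: "lin_ext bvec x = x"
  by (rule poly_mapping_eqI)
    (simp add: lin_ext_def lookup_sum lookup_scale bvec_def lookup_single when_def
      if_distrib sum.delta in_keys_iff cong: if_cong)

lemma lin_eq_lin_ext: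
  assumes "lin f" shows "f x = lin_ext (\<lambda>b. f (bvec b)) x"
proof -
  have "f x = f (lin_ext bvec x)" by (simp add: lin_ext_bvec_id)
  also have "\<dots> = lin_ext (\<lambda>b. f (bvec b)) x"
    by (simp add: lin_ext_def lin_sumD[OF assms] lin_scaleD[OF assms])
  finally show ?thesis .
qed

lemma lin_ext_cong: "(\<And>b. b \<in> Poly_Mapping.keys x \<Longrightarrow> F b = G b) \<Longrightarrow> lin_ext F x = lin_ext G x"
  unfolding lin_ext_def by (rule sum.cong) auto

text \<open>Two linear maps agree at \<open>x\<close> as soon as they agree on the basis vectors that occur in \<open>x\<close>. All
  multilinear identities below are reduced to basis vectors with this rule, one argument at a time.\<close>

lemma lin_eqI:
  assumes "lin f" "lin g" "\<And>b. b \<in> Poly_Mapping.keys x \<Longrightarrow> f (bvec b) = g (bvec b)"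
  shows "f x = g x"
  unfolding lin_eq_lin_ext[OF assms(1), of x] lin_eq_lin_ext[OF assms(2), of x]
  by (rule lin_ext_cong) (rule assms(3))

lemma lin_bilin_left: "lin (\<lambda>x. bilin_ext F x y)"
  unfolding bilin_ext_def by (rule lin_lin_ext)

lemma lin_lin_ext_param:
  "(\<And>b. lin (f b)) \<Longrightarrow> lin (\<lambda>x. lin_ext (\<lambda>b. f b x) y)"
  unfolding lin_ext_def by (intro lin_sum lin_scale)

lemma lin_bilin_right: "lin (bilin_ext F x)"
  unfolding bilin_ext_def using lin_lin_ext_param[of "\<lambda>a. lin_ext (F a)"] lin_lin_ext by blast

lemma bilin_bvec: "bilin_ext F (bvec a) (bvec b) = F a b"
  by (simp add: bilin_ext_def lin_ext_bvec)

lemmas lin_prepend = lin_lin_ext[of "\<lambda>w. bvec (n # w)" for n, folded prepend_def]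
lemmas lin_concat_left = lin_bilin_left[of "\<lambda>u v. bvec (u @ v)", folded concat_prod_def]
lemmas lin_concat_right = lin_bilin_right[of "\<lambda>u v. bvec (u @ v)", folded concat_prod_def]
lemmas lin_tensor_left = lin_bilin_left[of "\<lambda>u v. bvec (u, v)", folded tensor_def]
lemmas lin_tensor_right = lin_bilin_right[of "\<lambda>u v. bvec (u, v)", folded tensor_def]
lemmas lin_psi = lin_lin_ext[of psi_word, folded psi_def]

lemmas lin_basic = lin_lin_ext lin_bilin_left lin_bilin_right lin_prepend lin_concat_left
  lin_concat_right lin_tensor_left lin_tensor_right lin_psi
lemmas lin_intros = lin_id lin_add lin_scale lin_sum lin_basic lin_basic[THEN lin_comp]

lemma concat_bvec: "concat_prod (bvec u) (bvec v) = bvec (u @ v)"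
  by (simp add: concat_prod_def bilin_bvec)
lemma tensor_bvec: "tensor (bvec u) (bvec v) = bvec (u, v)"
  by (simp add: tensor_def bilin_bvec)
lemma prepend_bvec: "prepend n (bvec v) = bvec (n # v)"
  by (simp add: prepend_def lin_ext_bvec)
lemma psi_bvec: "psi (bvec v) = psi_word v"
  by (simp add: psi_def lin_ext_bvec)

lemmas bvec_simps = lin_ext_bvec bilin_bvec concat_bvec tensor_bvec prepend_bvec psi_bvec

lemma lin_ext_prepend: "lin_ext F (prepend n x) = lin_ext (\<lambda>w. F (n # w)) x"
  by (rule lin_eqI[where x = x]) (intro lin_intros | simp add: bvec_simps)+

lemma concat_letter: "concat_prod (bvec [n]) x = prepend n x"
  by (rule lin_eqI[where x = x]) (intro lin_intros | simp add: bvec_simps)+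


section \<open>Sums over deconcatenations\<close>

definition cut_sum :: "('a list \<Rightarrow> 'a list \<Rightarrow> 'v::comm_monoid_add) \<Rightarrow> 'a list \<Rightarrow> 'v"
  where "cut_sum B w = (\<Sum>i\<le>length w. B (take i w) (drop i w))"

lemma cut_sum_Nil [simp]: "cut_sum B [] = B [] []"
  by (simp add: cut_sum_def)

lemma cut_sum_Cons: "cut_sum B (n # w) = B [] (n # w) + cut_sum (\<lambda>a. B (n # a)) w"
  by (simp add: cut_sum_def sum.atMost_Suc_shift del: sum.atMost_Suc)

lemma cut_sum_add: "cut_sum (\<lambda>a b. F a b + G a b) w = cut_sum F w + cut_sum G w"
  by (simp add: cut_sum_def sum.distrib)

lemma cut_sum_diff:
  "cut_sum (\<lambda>a b. F a b - G a b :: 'v::ab_group_add) w = cut_sum F w - cut_sum G w"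
  by (simp add: cut_sum_def sum_subtractf)

lemma cut_sum_lin: "lin f \<Longrightarrow> f (cut_sum F w) = cut_sum (\<lambda>a b. f (F a b)) w"
  by (simp add: cut_sum_def lin_sumD)

lemmas cut_sum_scale = cut_sum_lin[OF lin_scale[OF lin_id]]

lemma cut_sum_cong:
  "(\<And>a b. a @ b = w \<Longrightarrow> F a b = G a b) \<Longrightarrow> cut_sum F w = cut_sum G w"
  by (simp add: cut_sum_def)

text \<open>Coassociativity of deconcatenation: both sides sum \<open>F a b c\<close> over the ways to cut \<open>w\<close> into
  three factors \<open>a\<close>, \<open>b\<close>, \<open>c\<close>.\<close>

lemma cut_sum_assoc:
  "cut_sum (\<lambda>a. cut_sum (F a)) w = cut_sum (\<lambda>d c. cut_sum (\<lambda>a b. F a b c) d) w"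
  by (induction w arbitrary: F) (simp_all add: cut_sum_Cons cut_sum_add add.assoc)

lemma cut_sum_swap: "cut_sum (\<lambda>a b. cut_sum (F a b) v) u = cut_sum (\<lambda>c d. cut_sum (\<lambda>a b. F a b c d) u) v"
  unfolding cut_sum_def by (rule sum.swap)

lemma cut_sum_zero: "(\<And>a b. a @ b = w \<Longrightarrow> F a b = 0) \<Longrightarrow> cut_sum F w = 0"
  by (simp add: cut_sum_def)

text \<open>If a double sum over cuts of \<open>u\<close> and \<open>v\<close> has no terms with two nonempty prefixes or with two empty
  ones, only the two axes remain.\<close>

lemma cut_sum_axes:
  assumes "u \<noteq> []" "v \<noteq> []" "G [] u [] v = 0"
    and "\<And>a b c d. a @ b = u \<Longrightarrow> c @ d = v \<Longrightarrow> a \<noteq> [] \<Longrightarrow> c \<noteq> [] \<Longrightarrow> G a b c d = 0"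
  shows "cut_sum (\<lambda>a b. cut_sum (G a b) v) u =
    cut_sum (\<lambda>a b. G a b [] v) u + cut_sum (G [] u) v"
proof -
  obtain n u' m v' where uv: "u = n # u'" "v = m # v'"
    using assms by (metis neq_Nil_conv)
  have "cut_sum (\<lambda>a b. cut_sum (G (n # a) b) v) u' = cut_sum (\<lambda>a b. G (n # a) b [] v) u'"
  proof -
    have "cut_sum (G (n # a) b) v = G (n # a) b [] v" if "a @ b = u'" for a b
      using that unfolding uv(2) cut_sum_Cons
      by (subst cut_sum_zero) (auto intro!: assms(4) simp: uv)
    then show ?thesis by (auto intro: cut_sum_cong)
  qed
  then show ?thesis
    using assms(3) by (simp add: uv cut_sum_Cons[of _ n] add.commute)
qed


section \<open>Compatibility of the divided quasi-shuffle product with deconcatenation\<close>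

lemma dqshuffle_Nil2 [simp]: "dqshuffle u [] = bvec u"
  by (cases u) simp_all

lemma bilin_prepend: "bilin_ext F (prepend n x) y = bilin_ext (\<lambda>a. F (n # a)) x y"
  by (simp add: bilin_ext_def lin_ext_prepend)

lemma lin_ext_add: "lin_ext (\<lambda>b. F b + G b) x = lin_ext F x + lin_ext G x"
  by (simp add: lin_ext_def scale_right_distrib sum.distrib)

lemma lin_ext_cut_sum_prepend:
  "lin_ext (cut_sum B) (prepend n x) =
    lin_ext (B []) (prepend n x) + lin_ext (cut_sum (\<lambda>a. B (n # a))) x"
  by (simp add: lin_ext_prepend cut_sum_Cons lin_ext_add)

lemmas lin_distrib = lin_addD lin_diffD lin_scaleD

text \<open>With \<open>B\<close> read as a bilinear map on the tensor square, this says
  \<open>\<Delta> (u \<star> v) = (\<Sum>u = u' u'', v = v' v''. (u' \<star> v') \<otimes> (u'' \<star> v''))\<close>. It holds because each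
  of the four terms of the recursion for \<open>\<star>\<close> puts a single letter in front of a shorter product:
  a cut either precedes that letter or is a cut of the shorter product. Leaving \<open>B\<close> arbitrary lets the
  induction absorb the letter into \<open>B\<close>.\<close>

lemma lin_ext_cut_sum_dqshuffle:
  "lin_ext (cut_sum B) (dqshuffle u v) =
    cut_sum (\<lambda>u' u''. cut_sum (\<lambda>v' v''.
      bilin_ext B (dqshuffle u' v') (dqshuffle u'' v'')) v) u"
proof (induction u v arbitrary: B rule: dqshuffle.induct)
  case (3 n u m v)
  let ?c = "1 / (of_nat n - of_nat m)"
  let ?Bn = "\<lambda>a. B (n # a)" and ?Bm = "\<lambda>a. B (m # a)"
  have Nil: "bilin_ext B (bvec []) y = lin_ext (B []) y" for y
    by (simp add: bilin_ext_def lin_ext_bvec)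
  have Cons: "bilin_ext B (bvec (k # w)) = bilin_ext (\<lambda>a. B (k # a)) (bvec w)" for k w
    by (intro ext) (simp add: bilin_ext_def lin_ext_bvec)
  have "lin_ext (cut_sum B) (dqshuffle (n # u) (m # v)) =
      lin_ext (B []) (dqshuffle (n # u) (m # v))
      + lin_ext (cut_sum ?Bn) (dqshuffle u (m # v)) + lin_ext (cut_sum ?Bm) (dqshuffle (n # u) v)
      + scale ?c (lin_ext (cut_sum ?Bn) (dqshuffle u v) - lin_ext (cut_sum ?Bm) (dqshuffle u v))"
    by (simp add: lin_distrib[OF lin_lin_ext] lin_ext_cut_sum_prepend lin_distrib[OF lin_scale[OF lin_id]]
        algebra_simps)
  then show ?case
    unfolding 3
    by (simp add: Nil Cons cut_sum_Cons cut_sum_add cut_sum_diff cut_sum_scale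
        lin_distrib[OF lin_bilin_left] bilin_prepend scale_right_diff_distrib add_ac)
qed (simp_all add: bvec_simps)


section \<open>Partial fractions\<close>

text \<open>Under \<open>[n] \<mapsto> 1 / (X - n)\<close> this is the partial fraction expansion of
  \<open>1 / (\<Prod>n\<in>S. X - n)\<close>.\<close>

definition partial_fraction :: "nat set \<Rightarrow> (nat list \<Rightarrow>\<^sub>0 'k::field_char_0)"
  where "partial_fraction S =
    (\<Sum>j\<in>S. scale (1 / (\<Prod>l\<in>S - {j}. of_nat j - of_nat l)) (bvec [j]))"

lemma partial_fraction_insert:
  assumes "finite S" "n \<notin> S"
  shows "partial_fraction (insert n S) = scale (1 / (\<Prod>l\<in>S. of_nat n - of_nat l)) (bvec [n])
    + (\<Sum>j\<in>S. scale (1 / ((of_nat j - of_nat n) * (\<Prod>l\<in>S - {j}. of_nat j - of_nat l))) (bvec [j]))"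
proof -
  have "insert n S - {j} = insert n (S - {j})" if "j \<in> S" for j
    using assms that by auto
  moreover have "insert n S - {n} = S" using assms by auto
  ultimately show ?thesis
    using assms by (simp add: partial_fraction_def)
qed

text \<open>The expansion of \<open>1 / ((X - n) (X - m)) = (1 / (X - n) - 1 / (X - m)) / (n - m)\<close>, multiplied by
  the fraction that belongs to \<open>S\<close>. It is what lets the third term of the recursion for the divided
  quasi-shuffle product merge two letters.\<close>

lemma partial_fraction_insert2:
  assumes "finite S" "n \<notin> S" "m \<notin> S" "n \<noteq> m"
  shows "partial_fraction (insert n (insert m S)) =
    scale (1 / (of_nat n - of_nat m)) (partial_fraction (insert n S) - partial_fraction (insert m S))"
proof -
  let ?A = "\<lambda>j. \<Prod>l\<in>S - {j}. of_nat j - of_nat l :: 'a"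
  \<comment> \<open>the coefficients of a letter of \<open>S\<close> on the two sides\<close>
  have c: "1 / ((of_nat j - of_nat n) * ((of_nat j - of_nat m) * ?A j)) =
      1 / (of_nat n - of_nat m) *
        (1 / ((of_nat j - of_nat n) * ?A j) - 1 / ((of_nat j - of_nat m) * ?A j))"
    if "j \<in> S" for j
  proof -
    have "?A j \<noteq> 0" "of_nat j - of_nat n \<noteq> (0::'a)" "of_nat j - of_nat m \<noteq> (0::'a)"
        "of_nat n - of_nat m \<noteq> (0::'a)"
      using assms that by auto
    then show ?thesis by (simp add: divide_simps)
  qed
  have S: "insert m S - {j} = insert m (S - {j})" if "j \<in> S" for j
    using assms that by auto
  have M: "insert m S - {m} = S" using assms by auto
  have neg: "scale (1 / ((of_nat m - of_nat n) * P)) x =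
    - scale (1 / (of_nat n - of_nat m)) (scale (1 / P) x)" for P :: 'a and x
    by (rule poly_mapping_eqI) (simp add: lookup_scale divide_simps, simp add: algebra_simps)
  let ?P = "\<lambda>k. \<Prod>l\<in>S. of_nat k - of_nat l :: 'a"
  let ?R = "\<lambda>k. \<Sum>j\<in>S. scale (1 / ((of_nat j - of_nat k) * ?A j)) (bvec [j])"
  have "partial_fraction (insert n (insert m S)) =
      scale (1 / ((of_nat n - of_nat m) * ?P n)) (bvec [n])
      + (scale (1 / ((of_nat m - of_nat n) * ?P m)) (bvec [m])
      + (\<Sum>j\<in>S. scale (1 / ((of_nat j - of_nat n) * ((of_nat j - of_nat m) * ?A j))) (bvec [j])))"
    using assms by (simp add: partial_fraction_insert S M)
  also have "(\<Sum>j\<in>S. scale (1 / ((of_nat j - of_nat n) * ((of_nat j - of_nat m) * ?A j))) (bvec [j])) =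
      scale (1 / (of_nat n - of_nat m)) (?R n - ?R m)"
    unfolding sum_subtractf[symmetric] scale_sum_right
    by (intro sum.cong refl) (simp only: c scale_scale[symmetric] scale_left_diff_distrib)
  also have "scale (1 / ((of_nat n - of_nat m) * ?P n)) (bvec [n])
      + (scale (1 / ((of_nat m - of_nat n) * ?P m)) (bvec [m])
      + scale (1 / (of_nat n - of_nat m)) (?R n - ?R m)) =
      scale (1 / (of_nat n - of_nat m))
        ((scale (1 / ?P n) (bvec [n]) + ?R n) - (scale (1 / ?P m) (bvec [m]) + ?R m))"
    by (simp add: neg scale_right_distrib scale_right_diff_distrib scale_scale)
  finally show ?thesis
    using assms by (simp add: partial_fraction_insert)
qed


section \<open>Logarithm coefficients summed over quasi-shuffles\<close>

text \<open>The coefficient of \<open>x ^ (i + j + 1)\<close> in \<open>log (1 + x)\<close>. The offset \<open>i\<close> counts letters that a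
  recursion has already removed from the front of a word, beyond the first one.\<close>

definition log_coeff :: "nat \<Rightarrow> nat \<Rightarrow> 'k::field_char_0"
  where "log_coeff i j = (- 1) ^ (i + j) / of_nat (Suc (i + j))"

text \<open>Removing the first letter of a word raises the offset \<open>i\<close> by one and moves the letter to the set
  \<open>T\<close>, so the statement for all \<open>i\<close> and \<open>T\<close> follows the recursion of the product. By
  \<open>partial_fraction_insert2\<close> all the terms are multiples of the same partial fraction. The scalar,
  with \<open>k\<close> and \<open>l\<close> the lengths of \<open>u\<close> and \<open>v\<close>, is a sum over quasi-shuffles that a
  balanced hypergeometric series of Saalschuetz type evaluates in closed form. Checking the closed form against the
  recursion reduces to
  \<open>(i + l + 2) + (i + k + 2) - (i + k + l + 3) = i + 1\<close>.\<close>

lemma lin_ext_log_coeff_dqshuffle: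
  assumes "distinct u" "distinct v" "set u \<inter> set v = {}" "finite T"
    "T \<inter> (set u \<union> set v) = {}"
  shows "lin_ext (\<lambda>w. scale (log_coeff i (length w)) (partial_fraction (T \<union> set w))) (dqshuffle u v) =
    scale ((- 1) ^ (i + length u + length v) * fact (i + length u) * fact (i + length v) /
        (fact i * fact (Suc (i + length u + length v))))
      (partial_fraction (T \<union> set u \<union> set v) :: nat list \<Rightarrow>\<^sub>0 'k::field_char_0)"
  using assms
proof (induction u v arbitrary: i T rule: dqshuffle.induct)
  case (3 n u m v)
  let ?L = "\<lambda>i T. lin_ext (\<lambda>w. scale (log_coeff i (length w)) (partial_fraction (T \<union> set w)))
    :: _ \<Rightarrow> (nat list \<Rightarrow>\<^sub>0 'k)"
  let ?S = "T \<union> set u \<union> set v"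
  let ?d = "1 / (of_nat n - of_nat m) :: 'k"
  let ?k = "length u" and ?l = "length v"
  let ?e = "\<lambda>i k l. (- 1) ^ (i + k + l) * fact (i + k) * fact (i + l) /
        (fact i * fact (Suc (i + k + l))) :: 'k"
  have peel: "?L i T (prepend p x) = ?L (Suc i) (insert p T) x" for p x
    by (simp add: lin_ext_prepend log_coeff_def)
  have "?L i T (dqshuffle (n # u) (m # v)) =
      ?L (Suc i) (insert n T) (dqshuffle u (m # v)) + ?L (Suc i) (insert m T) (dqshuffle (n # u) v)
      + scale ?d (?L (Suc i) (insert n T) (dqshuffle u v) - ?L (Suc i) (insert m T) (dqshuffle u v))"
    by (simp add: lin_distrib[OF lin_lin_ext] peel)
  also have "?L (Suc i) (insert n T) (dqshuffle u (m # v)) =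
      scale (?e (Suc i) ?k (Suc ?l)) (partial_fraction (insert n (insert m ?S)))"
    using 3 by (subst 3) (auto simp: insert_commute)
  also have "?L (Suc i) (insert m T) (dqshuffle (n # u) v) =
      scale (?e (Suc i) (Suc ?k) ?l) (partial_fraction (insert n (insert m ?S)))"
    using 3 by (subst 3) (auto simp: insert_commute)
  also have "?L (Suc i) (insert n T) (dqshuffle u v) =
      scale (?e (Suc i) ?k ?l) (partial_fraction (insert n ?S))"
    using 3 by (subst 3) auto
  also have "?L (Suc i) (insert m T) (dqshuffle u v) =
      scale (?e (Suc i) ?k ?l) (partial_fraction (insert m ?S))"
    using 3 by (subst 3) auto
  also have "scale ?d (scale (?e (Suc i) ?k ?l) (partial_fraction (insert n ?S)) -
      scale (?e (Suc i) ?k ?l) (partial_fraction (insert m ?S))) =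
      scale (?e (Suc i) ?k ?l) (partial_fraction (insert n (insert m ?S)))"
    using 3
    by (subst partial_fraction_insert2) (auto simp: scale_right_diff_distrib scale_scale mult.commute)
  also have "scale (?e (Suc i) ?k (Suc ?l)) (partial_fraction (insert n (insert m ?S)))
      + scale (?e (Suc i) (Suc ?k) ?l) (partial_fraction (insert n (insert m ?S)))
      + scale (?e (Suc i) ?k ?l) (partial_fraction (insert n (insert m ?S)))
      = scale (?e i (Suc ?k) (Suc ?l)) (partial_fraction (insert n (insert m ?S)))"
    unfolding scale_left_distrib[symmetric]
  proof (rule arg_cong[where f = "\<lambda>c. scale c _"])
    define a b c d N :: 'k where "a = fact (Suc (i + ?k))" and "b = fact (Suc (i + ?l))"
      and "c = fact i" and "d = fact (Suc (Suc (i + ?k + ?l)))" and "N = of_nat (i + ?k + ?l) + 3"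
    have f: "fact (Suc (Suc (i + ?k))) = (of_nat (i + ?k) + 2) * a"
      "fact (Suc (Suc (i + ?l))) = (of_nat (i + ?l) + 2) * b"
      "fact (Suc i) = (of_nat i + 1) * c" "fact (Suc (Suc (Suc (i + ?k + ?l)))) = N * d"
      unfolding a_def b_def c_def d_def N_def by (simp_all only: fact_Suc of_nat_Suc) algebra+
    have "d \<noteq> 0" unfolding d_def by (rule fact_nonzero)
    then have nz: "c \<noteq> 0" "d \<noteq> 0" "N \<noteq> 0" "of_nat i + 1 \<noteq> (0::'k)"
      using of_nat_neq_0[of "i + ?k + ?l + 2", where 'a = 'k] of_nat_neq_0[of i, where 'a = 'k]
      by (simp_all add: c_def N_def add_ac)
    let ?s = "(- 1) ^ (i + ?k + ?l) :: 'k"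
    have "?e (Suc i) ?k (Suc ?l) + ?e (Suc i) (Suc ?k) ?l + ?e (Suc i) ?k ?l =
        ?s * a * ((of_nat (i + ?l) + 2) * b) / ((of_nat i + 1) * c * (N * d))
        + ?s * ((of_nat (i + ?k) + 2) * a) * b / ((of_nat i + 1) * c * (N * d))
        - ?s * a * b / ((of_nat i + 1) * c * d)"
      by (simp only: add_Suc add_Suc_right f a_def[symmetric] b_def[symmetric] d_def[symmetric]) simp
    also have "?s * a * b / ((of_nat i + 1) * c * d) =
        ?s * a * b * N / ((of_nat i + 1) * c * (N * d))"
      using nz by (simp add: mult.assoc)
    also have "?s * a * ((of_nat (i + ?l) + 2) * b) / ((of_nat i + 1) * c * (N * d))
        + ?s * ((of_nat (i + ?k) + 2) * a) * b / ((of_nat i + 1) * c * (N * d))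
        - ?s * a * b * N / ((of_nat i + 1) * c * (N * d)) =
        ?s * a * b * (of_nat i + 1) / ((of_nat i + 1) * c * (N * d))"
      by (simp add: N_def add_divide_distrib[symmetric] diff_divide_distrib[symmetric] algebra_simps)
    also have "\<dots> = ?s * a * b / (c * (N * d))"
      using nz by (simp add: mult.assoc)
    also have "\<dots> = ?e i (Suc ?k) (Suc ?l)"
      by (simp only: add_Suc add_Suc_right f a_def[symmetric] b_def[symmetric] c_def[symmetric]) simp
    finally show "?e (Suc i) ?k (Suc ?l) + ?e (Suc i) (Suc ?k) ?l + ?e (Suc i) ?k ?l
      = ?e i (Suc ?k) (Suc ?l)" .
  qed
  finally show ?case
    by (simp add: insert_commute Un_insert_right Un_ac)
next
  case (2 n u)
  have "of_nat (Suc (i + length u)) \<noteq> (0::'k)" by (rule of_nat_neq_0)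
  then show ?case by (simp add: bvec_simps log_coeff_def)
qed (simp add: bvec_simps log_coeff_def)


section \<open>The recursion for psi\<close>

text \<open>The component of \<open>psi_word w\<close> on one-letter words. On the empty word the block, and hence the
  value, is \<open>0\<close>, so that the empty prefix may be kept in sums over all cuts.\<close>

definition letter_part :: "nat list \<Rightarrow> (nat list \<Rightarrow>\<^sub>0 'k::field_char_0)"
  where "letter_part w = scale ((- 1) ^ (length w - 1) / of_nat (length w)) (block w 0 (length w))"

lemma block_drop:
  assumes "m \<le> length w"
  shows "block w (m + a) (m + b) = (block (drop m w) a b :: nat list \<Rightarrow>\<^sub>0 'k::field_char_0)"
proof -
  have "(\<Prod>l\<in>{a + m..<b + m} - {m + j}. of_nat (w ! (m + j)) - of_nat (w ! l)) =
      (\<Prod>l\<in>{a..<b} - {j}. of_nat (w ! (m + j)) - of_nat (w ! (m + l)) :: 'k)" for j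
    by (rule prod.reindex_bij_witness[of _ "\<lambda>l. l + m" "\<lambda>l. l - m"]) auto
  then show ?thesis
    using assms unfolding block_def
    by (simp add: add.commute[of m] sum.shift_bounds_nat_ivl)
qed

lemma block_take: "i \<le> length w \<Longrightarrow> block (take i w) 0 i = block w 0 i"
  unfolding block_def
  by (intro sum.cong arg_cong2[where f = scale] arg_cong2[where f = "(/)"] prod.cong refl) auto

lemma block_product_Cons:
  assumes "m \<le> length w"
  shows "block_product w (m # \<mu>) =
    concat_prod (block w 0 m) (block_product (drop m w) \<mu> :: nat list \<Rightarrow>\<^sub>0 'k::field_char_0)"
proof -
  have "map (\<lambda>s. block w (partial_sum (m # \<mu>) s) (partial_sum (m # \<mu>) (Suc s)))
      [0..<length (m # \<mu>)] = (block w 0 m #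
      map (\<lambda>s. block (drop m w) (partial_sum \<mu> s) (partial_sum \<mu> (Suc s))) [0..<length \<mu>]
      :: (nat list \<Rightarrow>\<^sub>0 'k) list)"
    using assms
    by (simp add: upt_conv_Cons map_Suc_upt[symmetric] partial_sum_def comp_def
        block_drop[symmetric] del: upt_Suc)
  then show ?thesis by (simp only: block_product_def foldr.simps comp_def)
qed

lemma compositions_0: "compositions 0 = {[]}"
  by (auto simp: compositions_def) (metis list.set_intros(1) neq_Nil_conv)

lemma compositions_eq_Cons:
  assumes "k > 0"
  shows "compositions k = (\<lambda>(i, \<mu>). i # \<mu>) ` (SIGMA i:{1..k}. compositions (k - i))"
proof (intro equalityI subsetI)
  fix \<mu> assume "\<mu> \<in> compositions k"
  then show "\<mu> \<in> (\<lambda>(i, \<mu>). i # \<mu>) ` (SIGMA i:{1..k}. compositions (k - i))"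
    using assms by (cases \<mu>) (auto simp: compositions_def intro!: rev_image_eqI[of "(hd \<mu>, tl \<mu>)"])
qed (auto simp: compositions_def)

lemma length_composition_le: "\<mu> \<in> compositions k \<Longrightarrow> length \<mu> \<le> k"
proof -
  have "length \<mu> \<le> sum_list \<mu>" if "0 \<notin> set \<mu>" for \<mu> :: "nat list"
    using that by (induction \<mu>) auto
  then show "\<mu> \<in> compositions k \<Longrightarrow> length \<mu> \<le> k" by (auto simp: compositions_def)
qed

text \<open>The empty word fits the general formula: its only composition is the empty one.\<close>

lemma psi_word_sum:
  "psi_word w = (\<Sum>\<mu>\<in>compositions (length w).
    scale ((- 1) ^ (length w - length \<mu>) / of_nat (prod_list \<mu>)) (block_product w \<mu>))"
  by (simp add: psi_word_def compositions_0 block_product_def scale_one)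

lemma letter_part_Nil [simp]: "letter_part [] = 0"
  by (simp add: letter_part_def scale_zero_left)

lemma letter_part_single: "letter_part [n] = bvec [n]"
  by (simp add: letter_part_def block_def scale_one)

lemma concat_zero [simp]: "concat_prod 0 x = 0"
  by (rule lin_zeroD[OF lin_concat_left])

text \<open>The sum over compositions is grouped by the first part \<open>i\<close>: the sign and the denominator are
  multiplicative, and the remaining parts run over the compositions for \<open>drop i w\<close>.\<close>

lemma psi_word_rec:
  assumes "w \<noteq> []"
  shows "psi_word w = cut_sum (\<lambda>a b. concat_prod (letter_part a) (psi_word b)) w"
proof -
  let ?k = "length w"
  let ?c = "\<lambda>k \<mu>. (- 1) ^ (k - length \<mu>) / of_nat (prod_list \<mu>) :: 'a"
  have inj: "inj_on (\<lambda>(i, \<mu>). i # \<mu>) (SIGMA i:{1..?k}. compositions (?k - i))"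
    by (auto simp: inj_on_def)
  have step: "(\<Sum>\<mu>\<in>compositions (?k - i). scale (?c ?k (i # \<mu>)) (block_product w (i # \<mu>))) =
      concat_prod (letter_part (take i w)) (psi_word (drop i w))" if i: "i \<in> {1..?k}" for i
  proof -
    have "scale (?c ?k (i # \<mu>)) (block_product w (i # \<mu>)) =
        concat_prod (letter_part (take i w))
          (scale (?c (?k - i) \<mu>) (block_product (drop i w) \<mu>))"
      if \<mu>: "\<mu> \<in> compositions (?k - i)" for \<mu>
    proof -
      have "?k - length (i # \<mu>) = (i - 1) + (?k - i - length \<mu>)"
        using length_composition_le[OF \<mu>] i by simp arith
      then have coeff: "?c ?k (i # \<mu>) = (- 1) ^ (i - 1) / of_nat i * ?c (?k - i) \<mu>"
        by (simp only: power_add) simp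
      show ?thesis
        unfolding coeff using i
        by (simp add: block_product_Cons letter_part_def block_take min_absorb2
            lin_scaleD[OF lin_concat_left] lin_scaleD[OF lin_concat_right] scale_scale mult_ac)
    qed
    then show ?thesis
      by (simp add: psi_word_sum lin_sumD[OF lin_concat_right])
  qed
  have "psi_word w = (\<Sum>i\<in>{1..?k}. \<Sum>\<mu>\<in>compositions (?k - i).
      scale (?c ?k (i # \<mu>)) (block_product w (i # \<mu>)))"
    using assms
    by (subst psi_word_sum, subst compositions_eq_Cons, simp, subst sum.reindex[OF inj])
      (simp add: sum.Sigma finite_compositions split_beta comp_def)
  also have "\<dots> = (\<Sum>i\<in>{1..?k}. concat_prod (letter_part (take i w)) (psi_word (drop i w)))"
    by (intro sum.cong refl step)
  also have "\<dots> = (\<Sum>i\<le>?k. concat_prod (letter_part (take i w)) (psi_word (drop i w)))"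
    by (rule sum.mono_neutral_left) (auto simp: Suc_le_eq)
  finally show ?thesis by (simp add: cut_sum_def)
qed


section \<open>Supports\<close>

lemma keys_scale: "Poly_Mapping.keys (scale c x) \<subseteq> Poly_Mapping.keys x"
  by (auto simp: in_keys_iff lookup_scale)

lemma keys_bvec: "Poly_Mapping.keys (bvec b :: _ \<Rightarrow>\<^sub>0 'k::field) = {b}"
  by (simp add: bvec_def)

lemma keys_sum_le:
  "(\<And>i. i \<in> I \<Longrightarrow> Poly_Mapping.keys (f i) \<subseteq> S) \<Longrightarrow> Poly_Mapping.keys (sum f I) \<subseteq> S"
  by (rule order_trans[OF Poly_Mapping.keys_sum]) blast

lemma keys_lin_ext:
  "(\<And>b. b \<in> Poly_Mapping.keys x \<Longrightarrow> Poly_Mapping.keys (F b) \<subseteq> S) \<Longrightarrow>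
    Poly_Mapping.keys (lin_ext F x) \<subseteq> S"
  unfolding lin_ext_def by (intro keys_sum_le order_trans[OF keys_scale]) blast

lemma keys_prepend:
  "(\<And>w. w \<in> Poly_Mapping.keys x \<Longrightarrow> n # w \<in> S) \<Longrightarrow> Poly_Mapping.keys (prepend n x) \<subseteq> S"
  unfolding prepend_def by (intro keys_lin_ext) (simp add: keys_bvec)

lemma keys_concat:
  assumes "\<And>u v. u \<in> Poly_Mapping.keys x \<Longrightarrow> v \<in> Poly_Mapping.keys y \<Longrightarrow> u @ v \<in> S"
  shows "Poly_Mapping.keys (concat_prod x y) \<subseteq> S"
  unfolding concat_prod_def bilin_ext_def by (intro keys_lin_ext) (simp add: keys_bvec assms)

lemma keys_cut_sum:
  "(\<And>a b. a @ b = w \<Longrightarrow> Poly_Mapping.keys (F a b) \<subseteq> S) \<Longrightarrow>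
    Poly_Mapping.keys (cut_sum F w) \<subseteq> S"
  unfolding cut_sum_def by (intro keys_sum_le) simp

lemma keys_letter_part: "Poly_Mapping.keys (letter_part w) \<subseteq> (\<lambda>n. [n]) ` set w"
  unfolding letter_part_def block_def
  by (intro order_trans[OF keys_scale] keys_sum_le) (auto simp: keys_bvec)

lemma keys_letter_part_letters: "Poly_Mapping.keys (letter_part w) \<subseteq> range (\<lambda>n. [n])"
  using keys_letter_part by blast

text \<open>Products of words in generic position stay generic. This keeps the denominators of the blocks of all
  the words that occur nonzero.\<close>

lemma keys_dqshuffle:
  assumes "distinct u" "distinct v" "set u \<inter> set v = {}"
  shows "Poly_Mapping.keys (dqshuffle u v :: nat list \<Rightarrow>\<^sub>0 'k::field_char_0) \<subseteq>
    {w. distinct w \<and> set w \<subseteq> set u \<union> set v \<and> (w = [] \<longrightarrow> u = [] \<and> v = [])}"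
  using assms
proof (induction u v rule: dqshuffle.induct)
  case (3 n u m v)
  let ?K = "\<lambda>u v. Poly_Mapping.keys (dqshuffle u v :: nat list \<Rightarrow>\<^sub>0 'k)"
  let ?S = "\<lambda>u v. {w. distinct w \<and> set w \<subseteq> set u \<union> set v \<and> (w = [] \<longrightarrow> u = [] \<and> v = [])}"
  have d: "distinct u" "distinct v" "n \<notin> set u" "m \<notin> set v" "n \<noteq> m" "n \<notin> set v" "m \<notin> set u"
    "set u \<inter> set v = {}"
    using 3 by auto
  have K: "?K u (m # v) \<subseteq> ?S u (m # v)" "?K (n # u) v \<subseteq> ?S (n # u) v" "?K u v \<subseteq> ?S u v"
    using d by (intro 3; simp)+
  have step: "Poly_Mapping.keys (prepend p (dqshuffle a b) :: nat list \<Rightarrow>\<^sub>0 'k) \<subseteq> ?S (n # u) (m # v)"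
    if "?K a b \<subseteq> ?S a b" "p \<notin> set a \<union> set b" "insert p (set a \<union> set b) \<subseteq> set (n # u) \<union> set (m # v)"
    for p a b
  proof (rule keys_prepend)
    fix w assume "w \<in> ?K a b"
    then have "distinct w" "set w \<subseteq> set a \<union> set b" using that(1) by auto
    then show "p # w \<in> ?S (n # u) (m # v)" using that(2,3) by auto
  qed
  have "Poly_Mapping.keys (prepend n (dqshuffle u (m # v)) :: nat list \<Rightarrow>\<^sub>0 'k) \<subseteq> ?S (n # u) (m # v)"
    "Poly_Mapping.keys (prepend m (dqshuffle (n # u) v) :: nat list \<Rightarrow>\<^sub>0 'k) \<subseteq> ?S (n # u) (m # v)"
    "Poly_Mapping.keys (prepend n (dqshuffle u v) :: nat list \<Rightarrow>\<^sub>0 'k) \<subseteq> ?S (n # u) (m # v)"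
    "Poly_Mapping.keys (prepend m (dqshuffle u v) :: nat list \<Rightarrow>\<^sub>0 'k) \<subseteq> ?S (n # u) (m # v)"
    using d K by (intro step; auto)+
  then show ?case
    unfolding dqshuffle.simps
    by (intro order_trans[OF Poly_Mapping.keys_add] order_trans[OF keys_scale]
        order_trans[OF keys_diff] Un_least)
qed (auto simp: keys_bvec)


section \<open>The letter part vanishes on proper products\<close>

lemma block_eq_partial_fraction:
  assumes "distinct w"
  shows "block w 0 (length w) = partial_fraction (set w)"
proof -
  let ?I = "{0..<length w}"
  have inj: "inj_on ((!) w) ?I" using assms by (auto simp: inj_on_def nth_eq_iff_index_eq)
  have set: "set w = (!) w ` ?I" by (auto simp: set_conv_nth)
  have diff: "(!) w ` ?I - {w ! j} = (!) w ` (?I - {j})" if "j \<in> ?I" for j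
    using inj_on_image_set_diff[OF inj, of ?I "{j}"] that by simp
  have inj': "inj_on ((!) w) (?I - {j})" for j using inj by (rule inj_on_diff)
  show ?thesis
    unfolding block_def partial_fraction_def set sum.reindex[OF inj]
    by (rule sum.cong) (simp_all add: diff prod.reindex[OF inj'] comp_def del: set_upt)
qed

lemma letter_part_Cons:
  "distinct (n # w) \<Longrightarrow>
    letter_part (n # w) = scale (log_coeff 0 (length w)) (partial_fraction (insert n (set w)))"
  by (subst letter_part_def, subst block_eq_partial_fraction) (simp_all add: log_coeff_def)

text \<open>The summation formula above needs one letter to have been removed already, since the logarithm has
  no constant term. After one step of the recursion the three closed forms add up to a multiple of
  \<open>(l + 1) + (k + 1) - (k + l + 2) = 0\<close>, where \<open>k + 1\<close> and \<open>l + 1\<close> are the lengths of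
  \<open>u\<close> and \<open>v\<close>.\<close>

lemma lin_ext_letter_part_dqshuffle:
  assumes "distinct u" "distinct v" "set u \<inter> set v = {}" "u \<noteq> []" "v \<noteq> []"
  shows "lin_ext letter_part (dqshuffle u v :: nat list \<Rightarrow>\<^sub>0 'k::field_char_0) = 0"
proof -
  obtain n u' m v' where uv: "u = n # u'" "v = m # v'"
    using assms by (metis neq_Nil_conv)
  let ?L = "\<lambda>T. lin_ext (\<lambda>w. scale (log_coeff 0 (length w)) (partial_fraction (T \<union> set w)))
    :: _ \<Rightarrow> (nat list \<Rightarrow>\<^sub>0 'k)"
  have peel: "lin_ext letter_part (prepend p (dqshuffle a b :: nat list \<Rightarrow>\<^sub>0 'k)) =
      ?L {p} (dqshuffle a b)"
    if "distinct a" "distinct b" "set a \<inter> set b = {}" "p \<notin> set a \<union> set b" for p a b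
    unfolding lin_ext_prepend using keys_dqshuffle[OF that(1-3), where 'k = 'k] that(4)
    by (intro lin_ext_cong, subst letter_part_Cons) auto
  let ?S = "set u' \<union> set v'"
  let ?d = "1 / (of_nat n - of_nat m) :: 'k"
  let ?k = "length u'" and ?l = "length v'"
  let ?e = "\<lambda>k l. (- 1) ^ (k + l) * fact k * fact l / fact (Suc (k + l)) :: 'k"
  let ?P = "partial_fraction (insert n (insert m ?S)) :: nat list \<Rightarrow>\<^sub>0 'k"
  have L: "?L {p} (dqshuffle a b) =
      scale (?e (length a) (length b)) (partial_fraction (insert p (set a \<union> set b)))"
    if "distinct a" "distinct b" "set a \<inter> set b = {}" "p \<notin> set a \<union> set b" for p a b
    using that lin_ext_log_coeff_dqshuffle[of a b "{p}" 0, where 'k = 'k] by auto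
  have "lin_ext letter_part (dqshuffle u v) =
      ?L {n} (dqshuffle u' v) + ?L {m} (dqshuffle u v')
      + scale ?d (?L {n} (dqshuffle u' v') - ?L {m} (dqshuffle u' v'))"
    using assms unfolding uv dqshuffle.simps lin_distrib[OF lin_lin_ext]
    by (subst (1 2 3 4) peel) auto
  also have "?L {n} (dqshuffle u' v) = scale (?e ?k (Suc ?l)) ?P"
    using assms by (subst L) (auto simp: uv)
  also have "?L {m} (dqshuffle u v') = scale (?e (Suc ?k) ?l) ?P"
    using assms by (subst L) (auto simp: uv insert_commute)
  also have "?L {n} (dqshuffle u' v') = scale (?e ?k ?l) (partial_fraction (insert n ?S))"
    using assms by (subst L) (auto simp: uv)
  also have "?L {m} (dqshuffle u' v') = scale (?e ?k ?l) (partial_fraction (insert m ?S))"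
    using assms by (subst L) (auto simp: uv)
  also have "scale ?d (scale (?e ?k ?l) (partial_fraction (insert n ?S))
      - scale (?e ?k ?l) (partial_fraction (insert m ?S)))
      = scale (?e ?k ?l) ?P"
    using assms
    by (subst partial_fraction_insert2) (auto simp: uv scale_right_diff_distrib scale_scale mult.commute)
  also have "scale (?e ?k (Suc ?l)) ?P + scale (?e (Suc ?k) ?l) ?P + scale (?e ?k ?l) ?P =
      scale (?e ?k (Suc ?l) + ?e (Suc ?k) ?l + ?e ?k ?l) ?P"
    by (simp only: scale_left_distrib)
  also have "?e ?k (Suc ?l) + ?e (Suc ?k) ?l + ?e ?k ?l = 0"
  proof -
    define a b c N :: 'k where "a = fact ?k" and "b = fact ?l"
      and "c = fact (Suc (?k + ?l))" and "N = of_nat (?k + ?l) + 2"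
    have f: "fact (Suc ?k) = (of_nat ?k + 1) * a" "fact (Suc ?l) = (of_nat ?l + 1) * b"
      "fact (Suc (Suc (?k + ?l))) = N * c"
      unfolding a_def b_def c_def N_def by (simp_all only: fact_Suc of_nat_Suc) algebra+
    have "c \<noteq> 0" unfolding c_def by (rule fact_nonzero)
    moreover have "N \<noteq> 0"
      using of_nat_neq_0[of "?k + ?l + 1", where 'a = 'k] by (simp add: N_def add_ac)
    ultimately have "?e ?k ?l = (- 1) ^ (?k + ?l) * a * b * N / (N * c)"
      by (simp add: a_def b_def c_def)
    moreover have "?e ?k (Suc ?l) = - ((- 1) ^ (?k + ?l) * a * ((of_nat ?l + 1) * b) / (N * c))"
      "?e (Suc ?k) ?l = - ((- 1) ^ (?k + ?l) * ((of_nat ?k + 1) * a) * b / (N * c))"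
      by (simp_all only: add_Suc add_Suc_right f a_def[symmetric] b_def[symmetric]) simp_all
    ultimately show ?thesis
      by (simp add: N_def add_divide_distrib[symmetric] diff_divide_distrib[symmetric] algebra_simps)
  qed
  finally show ?thesis by (simp add: scale_zero_left)
qed


section \<open>Multiplicativity\<close>

lemma lin_eq_on_letters:
  assumes "lin f" "lin g" "Poly_Mapping.keys x \<subseteq> range (\<lambda>n. [n])" "\<And>n. f (bvec [n]) = g (bvec [n])"
  shows "f x = g x"
proof (rule lin_eqI[OF assms(1,2)])
  fix b assume "b \<in> Poly_Mapping.keys x"
  then obtain n where "b = [n]" using assms(3) by blast
  then show "f (bvec b) = g (bvec b)" using assms(4) by simp
qed

text \<open>The recursion of the shuffle product, linearly extended in the first letters.\<close>

lemma shuffle_concat_letters: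
  assumes "Poly_Mapping.keys q \<subseteq> range (\<lambda>n. [n])" "Poly_Mapping.keys r \<subseteq> range (\<lambda>n. [n])"
  shows "bilin_ext shuffle (concat_prod q x) (concat_prod r y) =
    concat_prod q (bilin_ext shuffle x (concat_prod r y))
    + concat_prod r (bilin_ext shuffle (concat_prod q x) y)"
proof (rule lin_eq_on_letters[OF _ _ assms(1)], (intro lin_intros)+)
  fix n
  show "bilin_ext shuffle (concat_prod (bvec [n]) x) (concat_prod r y) =
    concat_prod (bvec [n]) (bilin_ext shuffle x (concat_prod r y))
    + concat_prod r (bilin_ext shuffle (concat_prod (bvec [n]) x) y)"
  proof (rule lin_eq_on_letters[OF _ _ assms(2)], (intro lin_intros)+)
    fix m
    show "bilin_ext shuffle (concat_prod (bvec [n]) x) (concat_prod (bvec [m]) y) =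
      concat_prod (bvec [n]) (bilin_ext shuffle x (concat_prod (bvec [m]) y))
      + concat_prod (bvec [m]) (bilin_ext shuffle (concat_prod (bvec [n]) x) y)"
    proof (rule lin_eqI[where x = x], (intro lin_intros)+)
      fix u
      show "bilin_ext shuffle (concat_prod (bvec [n]) (bvec u)) (concat_prod (bvec [m]) y) =
        concat_prod (bvec [n]) (bilin_ext shuffle (bvec u) (concat_prod (bvec [m]) y))
        + concat_prod (bvec [m]) (bilin_ext shuffle (concat_prod (bvec [n]) (bvec u)) y)"
        by (rule lin_eqI[where x = y], (intro lin_intros)+) (simp add: bvec_simps concat_letter)
    qed
  qed
qed

lemma shuffle_Nil2: "shuffle u [] = bvec u"
  by (cases u) simp_all

lemma bilin_shuffle_Nil1: "bilin_ext shuffle (bvec []) y = y"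
  by (rule lin_eqI[where x = y], (intro lin_intros)+) (simp add: bvec_simps)

lemma bilin_shuffle_Nil2: "bilin_ext shuffle x (bvec []) = x"
  by (rule lin_eqI[where x = x], (intro lin_intros)+) (simp add: bvec_simps shuffle_Nil2)

text \<open>The shuffle recursion with only the second factor expanded by \<open>psi_word_rec\<close>. Keeping the first
  factor in the form \<open>q \<cdot> x\<close> makes it possible to resum it afterwards.\<close>

lemma shuffle_concat_letter_psi_word:
  assumes "Poly_Mapping.keys q \<subseteq> range (\<lambda>n. [n])" "v \<noteq> []"
  shows "bilin_ext shuffle (concat_prod q x) (psi_word v) =
    concat_prod q (bilin_ext shuffle x (psi_word v))
    + cut_sum (\<lambda>c d. concat_prod (letter_part c)
        (bilin_ext shuffle (concat_prod q x) (psi_word d))) v"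
  unfolding psi_word_rec[OF assms(2)]
  by (simp add: cut_sum_lin[OF lin_bilin_right] cut_sum_lin[OF lin_concat_right]
      shuffle_concat_letters[OF assms(1) keys_letter_part_letters] cut_sum_add)

text \<open>The product of \<open>psi_word u\<close> and \<open>psi_word v\<close> obeys the recursion that remains for
  \<open>psi (dqshuffle u v)\<close> once the letter part of proper products vanishes.\<close>

lemma shuffle_psi_word:
  assumes "u \<noteq> []" "v \<noteq> []"
  shows "bilin_ext shuffle (psi_word u) (psi_word v) =
    cut_sum (\<lambda>a b. concat_prod (letter_part a) (bilin_ext shuffle (psi_word b) (psi_word v))) u
    + cut_sum (\<lambda>c d. concat_prod (letter_part c) (bilin_ext shuffle (psi_word u) (psi_word d))) v"
proof -
  have "bilin_ext shuffle (psi_word u) (psi_word v) =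
      cut_sum (\<lambda>a b. bilin_ext shuffle (concat_prod (letter_part a) (psi_word b)) (psi_word v)) u"
    unfolding psi_word_rec[OF assms(1)] by (rule cut_sum_lin[OF lin_bilin_left])
  also have "\<dots> =
      cut_sum (\<lambda>a b. concat_prod (letter_part a) (bilin_ext shuffle (psi_word b) (psi_word v))) u
      + cut_sum (\<lambda>a b. cut_sum (\<lambda>c d. concat_prod (letter_part c)
        (bilin_ext shuffle (concat_prod (letter_part a) (psi_word b)) (psi_word d))) v) u"
    by (simp add: shuffle_concat_letter_psi_word[OF keys_letter_part_letters assms(2)] cut_sum_add)
  also have "cut_sum (\<lambda>a b. cut_sum (\<lambda>c d. concat_prod (letter_part c)
        (bilin_ext shuffle (concat_prod (letter_part a) (psi_word b)) (psi_word d))) v) u =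
      cut_sum (\<lambda>c d. concat_prod (letter_part c) (bilin_ext shuffle (psi_word u) (psi_word d))) v"
    unfolding psi_word_rec[OF assms(1)]
    by (subst cut_sum_swap) (simp add: cut_sum_lin[OF lin_concat_right] cut_sum_lin[OF lin_bilin_left])
  finally show ?thesis .
qed

lemma bilin_concat_letter_part_psi:
  "bilin_ext (\<lambda>a b. concat_prod (letter_part a) (psi_word b)) x y =
    concat_prod (lin_ext letter_part x) (psi y)"
proof (rule lin_eqI[where x = x], (intro lin_intros)+)
  fix a
  show "bilin_ext (\<lambda>a b. concat_prod (letter_part a) (psi_word b)) (bvec a) y =
      concat_prod (lin_ext letter_part (bvec a)) (psi y)"
    by (rule lin_eqI[where x = y], (intro lin_intros)+) (simp add: bvec_simps)
qed

text \<open>Among the pairs of cuts, those with two nonempty prefixes vanish by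
  \<open>lin_ext_letter_part_dqshuffle\<close>, and the one with two empty prefixes because the letter part of the
  empty word is \<open>0\<close>. In the others a nonempty prefix has been removed from one of the words, so the
  induction hypothesis applies.\<close>

lemma psi_dqshuffle:
  assumes "distinct u" "distinct v" "set u \<inter> set v = {}"
  shows "psi (dqshuffle u v) = bilin_ext shuffle (psi_word u) (psi_word v :: nat list \<Rightarrow>\<^sub>0 'k::field_char_0)"
  using assms
proof (induction "length u + length v" arbitrary: u v rule: less_induct)
  case less
  show ?case
  proof (cases "u = [] \<or> v = []")
    case True
    then show ?thesis
      by (auto simp: bvec_simps bilin_shuffle_Nil1 bilin_shuffle_Nil2 psi_word_def[of "[]"])
  next
    case False
    then have ne: "u \<noteq> []" "v \<noteq> []" by auto
    let ?G = "\<lambda>a b c d. concat_prod (lin_ext letter_part (dqshuffle a c)) (psi (dqshuffle b d))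
      :: nat list \<Rightarrow>\<^sub>0 'k"
    have "(psi (dqshuffle u v) :: nat list \<Rightarrow>\<^sub>0 'k) =
        lin_ext (cut_sum (\<lambda>a b. concat_prod (letter_part a) (psi_word b))) (dqshuffle u v)"
      unfolding psi_def using keys_dqshuffle[OF less.prems, where 'k = 'k] ne
      by (intro lin_ext_cong psi_word_rec) auto
    also have "\<dots> = cut_sum (\<lambda>a b. cut_sum (?G a b) v) u"
      by (simp add: lin_ext_cut_sum_dqshuffle bilin_concat_letter_part_psi)
    also have "\<dots> = cut_sum (\<lambda>a b. ?G a b [] v) u + cut_sum (?G [] u) v"
    proof (rule cut_sum_axes[OF ne])
      show "?G [] u [] v = 0" by (simp add: bvec_simps)
      fix a b c d
      assume "a @ b = u" "c @ d = v" "a \<noteq> []" "c \<noteq> []"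
      then show "?G a b c d = 0"
        using less.prems by (subst lin_ext_letter_part_dqshuffle) auto
    qed
    also have "cut_sum (\<lambda>a b. ?G a b [] v) u =
        cut_sum (\<lambda>a b. concat_prod (letter_part a) (bilin_ext shuffle (psi_word b) (psi_word v))) u"
    proof (rule cut_sum_cong)
      fix a b assume ab: "a @ b = u"
      show "?G a b [] v = concat_prod (letter_part a) (bilin_ext shuffle (psi_word b) (psi_word v))"
      proof (cases "a = []")
        case False
        have "(psi (dqshuffle b v) :: nat list \<Rightarrow>\<^sub>0 'k) = bilin_ext shuffle (psi_word b) (psi_word v)"
          using ab False less.prems by (intro less.hyps) auto
        then show ?thesis by (simp add: bvec_simps)
      qed (simp add: bvec_simps)
    qed
    also have "cut_sum (?G [] u) v =
        cut_sum (\<lambda>c d. concat_prod (letter_part c) (bilin_ext shuffle (psi_word u) (psi_word d))) v"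
    proof (rule cut_sum_cong)
      fix c d assume cd: "c @ d = v"
      show "?G [] u c d = concat_prod (letter_part c) (bilin_ext shuffle (psi_word u) (psi_word d))"
      proof (cases "c = []")
        case False
        have "(psi (dqshuffle u d) :: nat list \<Rightarrow>\<^sub>0 'k) = bilin_ext shuffle (psi_word u) (psi_word d)"
          using cd False less.prems by (intro less.hyps) auto
        then show ?thesis by (simp add: bvec_simps)
      qed (simp add: bvec_simps)
    qed
    also have "cut_sum (\<lambda>a b. concat_prod (letter_part a) (bilin_ext shuffle (psi_word b) (psi_word v))) u
      + cut_sum (\<lambda>c d. concat_prod (letter_part c) (bilin_ext shuffle (psi_word u) (psi_word d))) v =
        bilin_ext shuffle (psi_word u) (psi_word v)"
      by (rule shuffle_psi_word[OF ne, symmetric])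
    finally show ?thesis .
  qed
qed


section \<open>Comultiplicativity\<close>

lemma deconc_eq_cut_sum: "deconc w = cut_sum (\<lambda>a b. bvec (a, b)) w"
  by (simp add: deconc_def cut_sum_def)

lemma tensor_concat_left:
  "lin_ext (\<lambda>(a, b). tensor (concat_prod q (bvec a)) (bvec b)) (tensor x y) = tensor (concat_prod q x) y"
proof (rule lin_eqI[where x = x], (intro lin_intros)+)
  fix a
  show "lin_ext (\<lambda>(a, b). tensor (concat_prod q (bvec a)) (bvec b)) (tensor (bvec a) y) =
      tensor (concat_prod q (bvec a)) y"
    by (rule lin_eqI[where x = y], (intro lin_intros)+) (simp add: bvec_simps)
qed

text \<open>A cut of \<open>q \<cdot> x\<close>, with \<open>q\<close> a combination of letters, is either the trivial one in front or a cut
  of \<open>x\<close> with \<open>q\<close> put before its left factor.\<close>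

lemma deconc_concat_letters:
  assumes "Poly_Mapping.keys q \<subseteq> range (\<lambda>n. [n])"
  shows "lin_ext deconc (concat_prod q x) = tensor (bvec []) (concat_prod q x)
    + lin_ext (\<lambda>(a, b). tensor (concat_prod q (bvec a)) (bvec b)) (lin_ext deconc x)"
proof (rule lin_eqI[where x = x], (intro lin_intros)+)
  fix w
  have "lin_ext deconc (concat_prod q (bvec w)) = tensor (bvec []) (concat_prod q (bvec w))
      + cut_sum (\<lambda>a b. tensor (concat_prod q (bvec a)) (bvec b)) w"
  proof (rule lin_eq_on_letters[OF _ _ assms])
    show "lin (\<lambda>q. tensor (bvec []) (concat_prod q (bvec w))
        + cut_sum (\<lambda>a b. tensor (concat_prod q (bvec a)) (bvec b)) w)"
      unfolding cut_sum_def by (intro lin_intros)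
  qed (intro lin_intros | simp add: bvec_simps deconc_eq_cut_sum cut_sum_Cons)+
  then show "lin_ext deconc (concat_prod q (bvec w)) = tensor (bvec []) (concat_prod q (bvec w))
      + lin_ext (\<lambda>(a, b). tensor (concat_prod q (bvec a)) (bvec b)) (lin_ext deconc (bvec w))"
    by (simp add: bvec_simps deconc_eq_cut_sum cut_sum_lin[OF lin_lin_ext])
qed

text \<open>In the recursion for \<open>psi_word w\<close> the trivial cuts add up to \<open>[] \<otimes> psi w\<close>. The others
  give a sum over three factors \<open>w = a b c\<close> of \<open>(letter_part a \<cdot> psi b) \<otimes> psi c\<close>. By
  coassociativity the first two factors recombine to \<open>psi (a b)\<close>, except when \<open>a b\<close> is empty, which
  is the term that the trivial cuts supply.\<close>

lemma deconc_psi_word: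
  "lin_ext deconc (psi_word w :: nat list \<Rightarrow>\<^sub>0 'k::field_char_0) =
    cut_sum (\<lambda>a b. tensor (psi_word a) (psi_word b)) w"
proof (induction "length w" arbitrary: w rule: less_induct)
  case less
  show ?case
  proof (cases w)
    case Nil
    then show ?thesis by (simp add: psi_word_def[of "[]"] bvec_simps deconc_eq_cut_sum)
  next
    case (Cons n w')
    let ?q = "\<lambda>a b. concat_prod (letter_part a) (psi_word b) :: nat list \<Rightarrow>\<^sub>0 'k"
    have "lin_ext deconc (psi_word w) = cut_sum (\<lambda>a b. lin_ext deconc (?q a b)) w"
      using Cons by (simp add: psi_word_rec cut_sum_lin[OF lin_lin_ext])
    also have "\<dots> = cut_sum (\<lambda>a b. tensor (bvec []) (?q a b) +
        cut_sum (\<lambda>c d. tensor (?q a c) (psi_word d)) b) w"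
    proof (rule cut_sum_cong)
      fix a b assume ab: "a @ b = w"
      show "lin_ext deconc (?q a b) = tensor (bvec []) (?q a b) +
        cut_sum (\<lambda>c d. tensor (?q a c) (psi_word d)) b"
      proof (cases "a = []")
        case True
        then show ?thesis
          by (simp add: lin_zeroD[OF lin_lin_ext] lin_zeroD[OF lin_tensor_left]
              lin_zeroD[OF lin_tensor_right] cut_sum_zero)
      next
        case False
        then have "lin_ext deconc (psi_word b :: nat list \<Rightarrow>\<^sub>0 'k) =
            cut_sum (\<lambda>c d. tensor (psi_word c) (psi_word d)) b"
          using ab by (intro less) auto
        then show ?thesis
          by (simp add: deconc_concat_letters[OF keys_letter_part_letters]
              cut_sum_lin[OF lin_lin_ext] tensor_concat_left)
      qed
    qed
    also have "\<dots> = tensor (bvec []) (psi_word w) +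
        cut_sum (\<lambda>d c. cut_sum (\<lambda>a b. tensor (?q a b) (psi_word c)) d) w"
      using Cons by (simp add: psi_word_rec cut_sum_lin[OF lin_tensor_right] cut_sum_add cut_sum_assoc)
    also have "cut_sum (\<lambda>d c. cut_sum (\<lambda>a b. tensor (?q a b) (psi_word c)) d) w =
        cut_sum (\<lambda>d c. tensor (cut_sum ?q d) (psi_word c)) w"
      by (simp add: cut_sum_lin[OF lin_tensor_left])
    finally show ?thesis
      by (simp add: Cons cut_sum_Cons[of _ n w'] psi_word_def[of "[]"] psi_word_rec[of "n # _"]
          lin_zeroD[OF lin_tensor_left])
  qed
qed


section \<open>Unitriangularity and injectivity\<close>

lemma keys_psi_word_if:
  assumes "Poly_Mapping.keys (psi_word w - bvec w :: nat list \<Rightarrow>\<^sub>0 'k::field_char_0) \<subseteq>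
    {v. length v < length w \<and> set v \<subseteq> set w}"
  shows "Poly_Mapping.keys (psi_word w :: nat list \<Rightarrow>\<^sub>0 'k) \<subseteq>
    {v. length v \<le> length w \<and> set v \<subseteq> set w}"
proof -
  have "Poly_Mapping.keys (psi_word w :: nat list \<Rightarrow>\<^sub>0 'k) \<subseteq>
    Poly_Mapping.keys (psi_word w - bvec w :: nat list \<Rightarrow>\<^sub>0 'k)
      \<union> Poly_Mapping.keys (bvec w :: nat list \<Rightarrow>\<^sub>0 'k)"
    using Poly_Mapping.keys_add[of "psi_word w - bvec w" "bvec w :: nat list \<Rightarrow>\<^sub>0 'k"] by simp
  also have "\<dots> \<subseteq> {v. length v < length w \<and> set v \<subseteq> set w} \<union> {w}"
    unfolding keys_bvec by (rule Un_mono[OF assms order_refl])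
  finally show ?thesis by auto
qed

text \<open>In the recursion a prefix of length \<open>i\<close> contributes a single letter, so only \<open>i = 1\<close> can produce
  words of full length, and there the letter part is the letter itself.\<close>

lemma psi_word_unitriangular:
  "Poly_Mapping.keys (psi_word w - bvec w :: nat list \<Rightarrow>\<^sub>0 'k::field_char_0) \<subseteq>
    {v. length v < length w \<and> set v \<subseteq> set w}"
proof (induction "length w" arbitrary: w rule: less_induct)
  case less
  have keys_psi: "Poly_Mapping.keys (psi_word b :: nat list \<Rightarrow>\<^sub>0 'k) \<subseteq> {v. length v \<le> length b \<and> set v \<subseteq> set b}"
    if "length b < length w" for b
    by (rule keys_psi_word_if[OF less[OF that]])
  consider "w = []" | n where "w = [n]" | n m w' where "w = n # m # w'"
    by (metis neq_Nil_conv)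
  then show ?case
  proof cases
    case 1
    then show ?thesis by (simp add: psi_word_def)
  next
    case 2
    have "concat_prod (bvec [n]) (bvec []) = (bvec [n] :: nat list \<Rightarrow>\<^sub>0 'k)"
      by (simp add: bvec_simps)
    then show ?thesis
      by (simp add: 2 psi_word_rec cut_sum_Cons letter_part_single psi_word_def[of "[]"])
  next
    case 3
    let ?S = "{v. length v < length w \<and> set v \<subseteq> set w}"
    have eq: "psi_word w - bvec w = prepend n (psi_word (m # w') - bvec (m # w'))
        + cut_sum (\<lambda>a b. concat_prod (letter_part (n # m # a)) (psi_word b :: nat list \<Rightarrow>\<^sub>0 'k)) w'"
      by (simp add: 3 psi_word_rec[of "n # _"] cut_sum_Cons letter_part_single concat_letter
          lin_diffD[OF lin_prepend] bvec_simps)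
    have "Poly_Mapping.keys (prepend n (psi_word (m # w') - bvec (m # w') :: nat list \<Rightarrow>\<^sub>0 'k)) \<subseteq> ?S"
      using less[of "m # w'"] by (intro keys_prepend) (auto simp: 3)
    moreover have "Poly_Mapping.keys (cut_sum (\<lambda>a b. concat_prod (letter_part (n # m # a))
        (psi_word b :: nat list \<Rightarrow>\<^sub>0 'k)) w') \<subseteq> ?S"
    proof (intro keys_cut_sum keys_concat)
      fix a b p v
      assume ab: "a @ b = w'" and p: "p \<in> Poly_Mapping.keys (letter_part (n # m # a) :: nat list \<Rightarrow>\<^sub>0 'k)"
        and v: "v \<in> Poly_Mapping.keys (psi_word b :: nat list \<Rightarrow>\<^sub>0 'k)"
      obtain k where k: "p = [k]" "k \<in> set (n # m # a)"
        using subsetD[OF keys_letter_part p] by blast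
      have len: "length b < length w" and sub: "set a \<union> set b \<subseteq> set w"
        using ab 3 by auto
      have "length v \<le> length b" "set v \<subseteq> set b"
        using subsetD[OF keys_psi[OF len] v] by simp_all
      moreover have "Suc (length b) < length w" using ab 3 by auto
      ultimately show "p @ v \<in> ?S"
        using k sub by (auto simp: 3)
    qed
    ultimately show ?thesis
      unfolding eq by (intro order_trans[OF Poly_Mapping.keys_add] Un_least)
  qed
qed

lemmas keys_psi_word = keys_psi_word_if[OF psi_word_unitriangular]

text \<open>A longest word \<open>w\<close> of \<open>x\<close> has the same coefficient in \<open>psi x\<close> as in \<open>x\<close>, because no other
  word of \<open>x\<close> can reach it.\<close>

lemma psi_eq_0_imp:
  assumes "psi x = (0 :: nat list \<Rightarrow>\<^sub>0 'k::field_char_0)"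
  shows "x = 0"
proof (rule ccontr)
  assume "x \<noteq> 0"
  then have ne: "length ` Poly_Mapping.keys x \<noteq> {}" by (simp add: keys_eq_empty)
  have fin: "finite (length ` Poly_Mapping.keys x)" by simp
  obtain w where w: "w \<in> Poly_Mapping.keys x" "length w = Max (length ` Poly_Mapping.keys x)"
    using Max_in[OF fin ne] by auto
  have coeff: "Poly_Mapping.lookup (psi_word b) w = (if b = w then 1 else (0::'k))"
    if "b \<in> Poly_Mapping.keys x" for b
  proof -
    have "length b \<le> length w" using that w(2) by simp
    then have "w \<notin> Poly_Mapping.keys (psi_word b - bvec b :: nat list \<Rightarrow>\<^sub>0 'k)"
      using psi_word_unitriangular[of b, where 'k = 'k] by auto
    then show ?thesis
      by (auto simp: in_keys_iff lookup_minus bvec_def lookup_single when_def)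
  qed
  have "Poly_Mapping.lookup (psi x) w =
      (\<Sum>b\<in>Poly_Mapping.keys x. Poly_Mapping.lookup x b * Poly_Mapping.lookup (psi_word b) w)"
    by (simp add: psi_def lin_ext_def lookup_sum lookup_scale)
  also have "\<dots> = (\<Sum>b\<in>Poly_Mapping.keys x. if b = w then Poly_Mapping.lookup x w else 0)"
    by (rule sum.cong) (simp_all add: coeff)
  also have "\<dots> = Poly_Mapping.lookup x w"
    using w(1) by simp
  finally show False
    using w(1) assms by (simp add: in_keys_iff)
qed

lemma inj_psi: "inj psi"
proof (rule injI)
  fix x y :: "nat list \<Rightarrow>\<^sub>0 'k::field_char_0"
  assume "psi x = psi y"
  then have "psi (x - y) = 0" by (simp add: lin_diffD[OF lin_psi])
  then show "x = y" using psi_eq_0_imp[of "x - y"] by simp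
qed


section \<open>The regularizing bialgebra map\<close>

lemma psi_bilin_dqshuffle:
  assumes "\<And>u. u \<in> Poly_Mapping.keys x \<Longrightarrow> distinct u" "\<And>v. v \<in> Poly_Mapping.keys y \<Longrightarrow> distinct v"
    and "\<And>u v. u \<in> Poly_Mapping.keys x \<Longrightarrow> v \<in> Poly_Mapping.keys y \<Longrightarrow> set u \<inter> set v = {}"
  shows "psi (bilin_ext dqshuffle x y) = bilin_ext shuffle (psi x) (psi y)"
proof (rule lin_eqI[where x = x], (intro lin_intros)+)
  fix u assume u: "u \<in> Poly_Mapping.keys x"
  show "psi (bilin_ext dqshuffle (bvec u) y) = bilin_ext shuffle (psi (bvec u)) (psi y)"
  proof (rule lin_eqI[where x = y], (intro lin_intros)+)
    fix v assume "v \<in> Poly_Mapping.keys y"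
    then show "psi (bilin_ext dqshuffle (bvec u) (bvec v)) =
        bilin_ext shuffle (psi (bvec u)) (psi (bvec v))"
      using u assms by (simp add: bvec_simps psi_dqshuffle)
  qed
qed

lemma tensor_map_psi_deconc:
  "tensor_map psi (lin_ext deconc x) = lin_ext deconc (psi x)"
  unfolding tensor_map_def
  by (rule lin_eqI[where x = x], (intro lin_intros)+)
    (simp add: bvec_simps deconc_psi_word,
      simp add: bvec_simps deconc_eq_cut_sum cut_sum_lin[OF lin_lin_ext])

theorem theorem18:
  shows "linear_embedding_on (space QShgd) (space Sh)
           (psi :: (nat list \<Rightarrow>\<^sub>0 'k::field_char_0) \<Rightarrow> (nat list \<Rightarrow>\<^sub>0 'k)) \<and>
         regularizing_bialgebra_map QShgd Sh
           (psi :: (nat list \<Rightarrow>\<^sub>0 'k) \<Rightarrow> (nat list \<Rightarrow>\<^sub>0 'k))"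
proof -
  have keys: "Poly_Mapping.keys (psi x :: nat list \<Rightarrow>\<^sub>0 'k) \<subseteq> {v. 0 \<notin> set v \<and> length v \<le> n}"
    if "\<And>w. w \<in> Poly_Mapping.keys x \<Longrightarrow> 0 \<notin> set w \<and> length w \<le> n" for x n
    unfolding psi_def
    by (rule keys_lin_ext, rule order_trans[OF keys_psi_word]) (use that in fastforce)
  have filt: "psi ` filt QShgd n \<subseteq> (filt Sh n :: (nat list \<Rightarrow>\<^sub>0 'k) set)" for n
  proof clarify
    fix x :: "nat list \<Rightarrow>\<^sub>0 'k" assume "x \<in> filt QShgd n"
    then show "psi x \<in> filt Sh n"
      using keys[of x n]
      by (fastforce simp: filt_def space_def QShgd_def Sh_def generic_words_def words_def)
  qed
  have space: "psi ` space QShgd \<subseteq> (space Sh :: (nat list \<Rightarrow>\<^sub>0 'k) set)"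
  proof clarify
    fix x :: "nat list \<Rightarrow>\<^sub>0 'k" assume "x \<in> space QShgd"
    then have "x \<in> filt QShgd (Max (length ` Poly_Mapping.keys x))"
      by (simp add: filt_def QShgd_def)
    then show "psi x \<in> space Sh"
      using filt by (auto simp: filt_def)
  qed
  have lin: "linear_map_on (space QShgd) (space Sh) (psi :: _ \<Rightarrow> (nat list \<Rightarrow>\<^sub>0 'k))"
    using space by (simp add: linear_map_on_def lin_addD[OF lin_psi] lin_scaleD[OF lin_psi])
  have "psi (bilin_ext dqshuffle x y) = bilin_ext shuffle (psi x) (psi y)"
    if "x \<in> space QShgd" "y \<in> space QShgd" "generic_position QShgd x y" for x y :: "nat list \<Rightarrow>\<^sub>0 'k"
    by (rule psi_bilin_dqshuffle; use that in
        \<open>auto simp: space_def generic_position_def QShgd_def generic_words_def\<close>)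
  moreover have "psi (bvec []) = (bvec [] :: nat list \<Rightarrow>\<^sub>0 'k)"
    by (simp add: bvec_simps psi_word_def)
  ultimately have "regularizing_bialgebra_map QShgd Sh (psi :: _ \<Rightarrow> (nat list \<Rightarrow>\<^sub>0 'k))"
    using lin filt unfolding regularizing_bialgebra_map_def
    by (auto simp: QShgd_def Sh_def tensor_map_psi_deconc)
  then show ?thesis
    using lin inj_on_subset[OF inj_psi subset_UNIV] by (simp add: linear_embedding_on_def)
qed

end
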